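(* Let $(X,\omega_X)$ be a compact network. Then for every $\varepsilon>0$ there is a finite subset $X'\subseteq X$ such that $d_{\mathcal N}\big((X,\omega_X),(X',\omega_X|_{X'\times X'})\big)<\varepsilon$.
   Context: A network is a pair $(X,\omega_X)$ with $X$ a first countable topological space and $\omega_X:X\times X\to\mathbb R$ continuous; it is compact if $X$ is compact. Finite networks carry the discrete topology. A correspondence between $X$ and $Y$ is a relation $R\subseteq X\times Y$ whose projections to $X$ and $Y$ are surjective; $\mathrm{dis}(R)=\sup_{(x,y),(x',y')\in R}|\omega_X(x,x')-\omega_Y(y,y')|$; $d_{\mathcal N}(X,Y)=\tfrac12\inf_R\mathrm{dis}(R)$ over all correspondences $R$. *)

theory Defs
  imports "HOL-Analysis.Analysis"
begin

type_synonym 'a network = "'a topology \<times> ('a \<times> 'a \<Rightarrow> real)"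

(* The underlying set is the topspace of the first component; values of the weight function
   outside of topspace X \<times> topspace X are irrelevant. *)
definition is_network :: "'a network \<Rightarrow> bool" where
  "is_network N \<longleftrightarrow>
     first_countable (fst N) \<and>
     continuous_map (prod_topology (fst N) (fst N)) euclideanreal (snd N)"

definition is_compact_network :: "'a network \<Rightarrow> bool" where
  "is_compact_network N \<longleftrightarrow> is_network N \<and> compact_space (fst N)"

definition is_correspondence :: "'a set \<Rightarrow> 'b set \<Rightarrow> ('a \<times> 'b) set \<Rightarrow> bool" where
  "is_correspondence X Y R \<longleftrightarrow> R \<subseteq> X \<times> Y \<and> fst ` R = X \<and> snd ` R = Y"

(* The supremum and the infimum are taken in [0, \<infinity>], so that they are meaningful also for
   unbounded weights, and when one of the underlying sets is empty. *)
definition distortion ::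
  "('a \<times> 'a \<Rightarrow> real) \<Rightarrow> ('b \<times> 'b \<Rightarrow> real) \<Rightarrow> ('a \<times> 'b) set \<Rightarrow> ennreal" where
  "distortion \<omega>X \<omega>Y R =
     (SUP ((x, y), (x', y')) \<in> R \<times> R. ennreal \<bar>\<omega>X (x, x') - \<omega>Y (y, y')\<bar>)"

definition network_dist :: "'a network \<Rightarrow> 'b network \<Rightarrow> ennreal" where
  "network_dist N M =
     (INF R \<in> {R. is_correspondence (topspace (fst N)) (topspace (fst M)) R}.
        distortion (snd N) (snd M) R) / 2"

definition finite_subnetwork :: "('a \<times> 'a \<Rightarrow> real) \<Rightarrow> 'a set \<Rightarrow> 'a network" where
  "finite_subnetwork \<omega> X' = (discrete_topology X', restrict \<omega> (X' \<times> X'))"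

lemma is_network_finite_subnetwork: "is_network (finite_subnetwork \<omega> X')"
proof -
  have "first_countable (discrete_topology X')"
    unfolding first_countable_def
  proof
    fix x assume "x \<in> topspace (discrete_topology X')"
    then show "\<exists>\<B>. countable \<B> \<and> (\<forall>V\<in>\<B>. openin (discrete_topology X') V) \<and>
      (\<forall>U. openin (discrete_topology X') U \<and> x \<in> U \<longrightarrow> (\<exists>V\<in>\<B>. x \<in> V \<and> V \<subseteq> U))"
      by (intro exI[of _ "{{x}}"]) auto
  qed
  then show ?thesis
    by (simp add: is_network_def finite_subnetwork_def flip: prod_topology_discrete_topology)
qed

end

theory Submission
  imports Defs
begin

text \<open>
  By compactness of the second factor, \<open>x \<mapsto> f (x, \<cdot>)\<close> is continuous for the supremum norm. Applied
  to the weight and to its transpose, this yields an open cover of the space on each member of which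
  rows and columns of the weight are uniformly close to those at a centre. Sending each point
  to a centre of a finite subcover gives a map with finite image whose graph is a correspondence
  of small distortion.
\<close>

text \<open>The projection to \<open>X\<close> along the compact factor \<open>Y\<close> is a closed
  map. The points \<open>u\<close> for which some \<open>y\<close> violates the bound are the
  projection of the closed set where \<open>\<bar>g\<bar> \<ge> \<delta>\<close>. They exclude
  \<open>x\<close>, because \<open>g\<close> vanishes on the fibre over \<open>x\<close> and
  \<open>\<delta> > 0\<close>, so their complement is the required neighbourhood.\<close>

lemma compact_sections_uniformly_close:
  fixes f :: "'a \<times> 'b \<Rightarrow> real"
  assumes cont: "continuous_map (prod_topology X Y) euclideanreal f"
    and "compact_space Y" and x: "x \<in> topspace X" and "\<delta> > 0"
  obtains U where "openin X U" "x \<in> U"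
    "\<And>u y. u \<in> U \<Longrightarrow> y \<in> topspace Y \<Longrightarrow> \<bar>f (u, y) - f (x, y)\<bar> < \<delta>"
proof -
  let ?P = "prod_topology X Y"
  define g where "g p = f p - f (x, snd p)" for p
  have "continuous_map ?P ?P (\<lambda>p. (x, snd p))"
    using x by (intro continuous_map_pairedI) (auto simp: continuous_map_snd)
  from continuous_map_compose[OF this cont]
  have "continuous_map ?P euclideanreal (\<lambda>p. f (x, snd p))"
    by (simp add: o_def)
  with cont have "continuous_map ?P euclideanreal g"
    unfolding g_def by (intro continuous_map_diff)
  then have "continuous_map ?P euclideanreal (\<lambda>p. \<bar>g p\<bar>)"
    by (rule continuous_map_real_abs)
  then have "closedin ?P {p \<in> topspace ?P. \<bar>g p\<bar> \<in> {\<delta>..}}"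
    by (rule closedin_continuous_map_preimage) simp
  with closed_map_fst[OF \<open>compact_space Y\<close>]
  have closed: "closedin X (fst ` {p \<in> topspace ?P. \<bar>g p\<bar> \<in> {\<delta>..}})" (is "closedin X ?C")
    unfolding closed_map_def by blast
  show ?thesis
  proof
    show "openin X (topspace X - ?C)"
      using closed by blast
    show "x \<in> topspace X - ?C"
      using x \<open>\<delta> > 0\<close> by (auto simp: g_def)
    show "\<bar>f (u, y) - f (x, y)\<bar> < \<delta>"
      if u: "u \<in> topspace X - ?C" and y: "y \<in> topspace Y" for u y
    proof (rule ccontr)
      assume "\<not> \<bar>f (u, y) - f (x, y)\<bar> < \<delta>"
      then have "(u, y) \<in> {p \<in> topspace ?P. \<bar>g p\<bar> \<in> {\<delta>..}}"
        using u y by (auto simp: g_def)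
      then have "u \<in> ?C"
        by force
      with u show False
        by blast
    qed
  qed
qed

text \<open>The graph of \<open>p\<close> is a correspondence between the space and the image of
  \<open>p\<close>. Continuity of \<open>p\<close> does not enter, so an arbitrary choice of nearby
  centres may be fed in.\<close>

lemma network_dist_le_of_map:
  assumes "\<And>x x'. x \<in> topspace X \<Longrightarrow> x' \<in> topspace X \<Longrightarrow>
      \<bar>\<omega> (x, x') - \<omega> (p x, p x')\<bar> \<le> \<delta>"
  shows "network_dist (X, \<omega>) (finite_subnetwork \<omega> (p ` topspace X)) \<le> ennreal \<delta> / 2"
proof -
  let ?R = "(\<lambda>x. (x, p x)) ` topspace X"
  have "is_correspondence (topspace X) (p ` topspace X) ?R"
    by (auto simp: is_correspondence_def image_image)
  \<comment> \<open>Second components of pairs in \<open>?R\<close> lie in the image of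
    \<open>p\<close>, where \<open>restrict\<close> returns \<open>\<omega>\<close> itself.\<close>
  moreover have "distortion \<omega> (restrict \<omega> (p ` topspace X \<times> p ` topspace X)) ?R \<le> ennreal \<delta>"
    unfolding distortion_def using assms by (intro SUP_least) (auto intro: ennreal_leI)
  ultimately show ?thesis
    unfolding network_dist_def finite_subnetwork_def
    by (intro divide_right_mono_ennreal) (auto intro: INF_lower2)
qed

theorem mainTheorem3:
  fixes X :: "'a topology" and \<omega> :: "'a \<times> 'a \<Rightarrow> real" and \<epsilon> :: real
  assumes "is_compact_network (X, \<omega>)"
    and "\<epsilon> > 0"
  shows "\<exists>X'. finite X' \<and> X' \<subseteq> topspace X \<and>
           network_dist (X, \<omega>) (finite_subnetwork \<omega> X') < ennreal \<epsilon>"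
proof -
  have cont: "continuous_map (prod_topology X X) euclideanreal \<omega>" and comp: "compact_space X"
    using assms by (auto simp: is_compact_network_def is_network_def)
  have "continuous_map (prod_topology X X) (prod_topology X X) (\<lambda>p. (snd p, fst p))"
    by (intro continuous_map_pairedI continuous_map_fst continuous_map_snd)
  from continuous_map_compose[OF this cont]
  have cont': "continuous_map (prod_topology X X) euclideanreal (\<lambda>p. \<omega> (snd p, fst p))"
    by (simp add: o_def)
  \<comment> \<open>Both rows and columns are controlled, since the two arguments of
    \<open>\<omega>\<close> are moved to centres one after the other, each at a cost below
    \<open>\<epsilon> / 2\<close>.\<close>
  define close where "close c u \<longleftrightarrow> (\<forall>z \<in> topspace X.
      \<bar>\<omega> (u, z) - \<omega> (c, z)\<bar> < \<epsilon> / 2 \<and> \<bar>\<omega> (z, u) - \<omega> (z, c)\<bar> < \<epsilon> / 2)" for c u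
  have "\<exists>U. openin X U \<and> c \<in> U \<and> (\<forall>u \<in> U. close c u)" if c: "c \<in> topspace X" for c
  proof -
    obtain U where U: "openin X U" "c \<in> U"
      "\<And>u z. u \<in> U \<Longrightarrow> z \<in> topspace X \<Longrightarrow> \<bar>\<omega> (u, z) - \<omega> (c, z)\<bar> < \<epsilon> / 2"
      using compact_sections_uniformly_close[OF cont comp c, of "\<epsilon> / 2"] \<open>\<epsilon> > 0\<close> by auto
    obtain V where V: "openin X V" "c \<in> V"
      "\<And>u z. u \<in> V \<Longrightarrow> z \<in> topspace X \<Longrightarrow> \<bar>\<omega> (z, u) - \<omega> (z, c)\<bar> < \<epsilon> / 2"
      using compact_sections_uniformly_close[OF cont' comp c, of "\<epsilon> / 2"] \<open>\<epsilon> > 0\<close> by auto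
    show ?thesis
      using U V by (intro exI[of _ "U \<inter> V"]) (auto simp: close_def)
  qed
  then obtain U where U: "\<And>c. c \<in> topspace X \<Longrightarrow> openin X (U c)"
      "\<And>c. c \<in> topspace X \<Longrightarrow> c \<in> U c"
      "\<And>c u. c \<in> topspace X \<Longrightarrow> u \<in> U c \<Longrightarrow> close c u"
    by metis
  have "\<forall>W \<in> U ` topspace X. openin X W" "topspace X \<subseteq> \<Union>(U ` topspace X)"
    using U(1,2) by auto
  with comp obtain \<F> where "finite \<F>" "\<F> \<subseteq> U ` topspace X" "topspace X \<subseteq> \<Union>\<F>"
    unfolding compact_space_alt by metis
  moreover from this(1,2) obtain F where "F \<subseteq> topspace X" "finite F" "\<F> = U ` F"
    using finite_subset_image by metis
  ultimately have F: "finite F" "F \<subseteq> topspace X" "topspace X \<subseteq> (\<Union>c \<in> F. U c)"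
    by auto
  then have "\<exists>c \<in> F. close c x" if "x \<in> topspace X" for x
    using U(3) that by blast
  then obtain p where p: "\<And>x. x \<in> topspace X \<Longrightarrow> p x \<in> F \<and> close (p x) x"
    by metis
  \<comment> \<open>The finite subset will be this image and not \<open>F\<close>: the graph of
    \<open>p\<close> must project onto it, and some centres in \<open>F\<close> may never be
    chosen.\<close>
  have sub: "p ` topspace X \<subseteq> F"
    using p by blast
  have "\<bar>\<omega> (x, x') - \<omega> (p x, p x')\<bar> \<le> \<epsilon>" if x: "x \<in> topspace X" and x': "x' \<in> topspace X" for x x'
  proof -
    have "\<bar>\<omega> (x, x') - \<omega> (p x, x')\<bar> < \<epsilon> / 2"
      using p[OF x] x' by (auto simp: close_def)
    \<comment> \<open>Here the column estimate at the centre \<open>p x'\<close> is evaluated in the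
      row \<open>p x\<close>, a point of the space because \<open>F\<close> lies in it.\<close>
    moreover have "\<bar>\<omega> (p x, x') - \<omega> (p x, p x')\<bar> < \<epsilon> / 2"
      using p[OF x] p[OF x'] F(2) by (auto simp: close_def)
    ultimately show ?thesis
      by linarith
  qed
  then have "network_dist (X, \<omega>) (finite_subnetwork \<omega> (p ` topspace X)) \<le> ennreal \<epsilon> / 2"
    by (rule network_dist_le_of_map)
  also have "\<dots> = ennreal (\<epsilon> / 2)"
    using \<open>\<epsilon> > 0\<close> by (simp add: ennreal_divide_numeral)
  \<comment> \<open>The factor one half in \<open>network_dist\<close> turns the non-strict bound on
    the distortion into a strict inequality.\<close>
  also have "\<dots> < ennreal \<epsilon>"
    using \<open>\<epsilon> > 0\<close> by (simp add: ennreal_less_iff)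
  finally show ?thesis
    using sub F by (meson finite_subset order_trans)
qed

end
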